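(* Let $S$ be any strictly proper scoring rule and, for error rates $e_z^+,e_z^-\in[0,1]$ with $e_z^++e_z^-\neq1$, define $\mathrm{SSR}_\alpha$ by $$R(q,z=1)=\frac{(1-e_z^-)S(q,1)-e_z^+S(q,0)}{1-e_z^+-e_z^-},\qquad R(q,z=0)=\frac{(1-e_z^+)S(q,0)-e_z^-S(q,1)}{1-e_z^+-e_z^-}.$$ Then $\mathrm{SSR}_\alpha$ is a surrogate scoring rule, and for all $p_i,q_i,e_z^+,e_z^-\in[0,1]$ with $e_z^++e_z^-\neq 1$, $$\mathbb E_z[R(q_i,z)]=\mathbb E_y[S(q_i,y)],$$ where $y$ is the ground truth drawn from $\mathrm{Bernoulli}(p_i)$ and $z\in\{0,1\}$ is the noisy ground truth generated by $y$ with error rates $e_z^+,e_z^-$.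
   Context: Error rates of a noisy ground truth $z\in\{0,1\}$ for a binary ground truth $y\in\{0,1\}$: $e_z^+=\Pr[z=0\mid y=1]$, $e_z^-=\Pr[z=1\mid y=0]$. Strictly proper scoring rule: a function $S:[0,1]\times\{0,1\}\to\mathbb R$ such that for all $p\neq q$ in $[0,1]$, $\mathbb E_{y\sim \mathrm{Bernoulli}(p)}[S(p,y)]>\mathbb E_{y\sim \mathrm{Bernoulli}(p)}[S(q,y)]$. Surrogate scoring rule: a function $R:[0,1]\times\{0,1\}\to\mathbb R_+$ of a prediction $q$ and a realized noisy ground truth $z$ (the function may depend on the error rates $e_z^+,e_z^-$) such that for some strictly proper scoring rule $S:[0,1]\times\{0,1\}\to\mathbb R_+$ and some strictly increasing function $f:\mathbb R_+\to\mathbb R_+$ it holds for all $p_i,q_i,e_z^+,e_z^-\in[0,1]$ with $e_z^++e_z^-\ne1$ that $\mathbb E_z[R(q_i,z)]=f(\mathbb E_y[S(q_i,y)])$, where $y\sim\mathrm{Bernoulli}(p_i)$ and $z$ is generated by $y$ with error rates $e_z^+,e_z^-$.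
   Formalization: The surrogate rule R may take negative values, since R ≥ 0 at all error rates fails for every strictly proper S (e.g. 1-(q-y)² at q=0, e⁻=0, e⁺=1/2 gives R(0,1)=-1); for S that is not nonnegative, the scoring rule and f in the definition are real-valued, not R_+-valued. *)

theory Defs
  imports "HOL-Probability.Probability"
begin

text \<open>
  Binary outcomes $0,1$ are the booleans \<^const>\<open>False\<close>, \<^const>\<open>True\<close>.  Functions on
  $[0,1]\times\{0,1\}$ are total functions whose values outside $[0,1]$ are irrelevant.
\<close>

definition strictly_proper_scoring_rule :: "(real \<Rightarrow> bool \<Rightarrow> real) \<Rightarrow> bool" where
  "strictly_proper_scoring_rule S \<longleftrightarrow>
     (\<forall>p\<in>{0..1}. \<forall>q\<in>{0..1}. p \<noteq> q \<longrightarrow>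
        measure_pmf.expectation (bernoulli_pmf p) (S p) >
        measure_pmf.expectation (bernoulli_pmf p) (S q))"

text \<open>
  The noisy ground truth $z$ given $y$: the error rates are
  $e^+ = \Pr[z=0 \mid y=1]$ (\<open>ep\<close>) and $e^- = \Pr[z=1 \mid y=0]$ (\<open>em\<close>).
\<close>

definition noisy_given :: "real \<Rightarrow> real \<Rightarrow> bool \<Rightarrow> bool pmf" where
  "noisy_given ep em y = bernoulli_pmf (if y then 1 - ep else em)"

definition noisy_truth :: "real \<Rightarrow> real \<Rightarrow> real \<Rightarrow> bool pmf" where
  "noisy_truth p ep em = bernoulli_pmf p \<bind> noisy_given ep em"

text \<open>
  \<open>R ep em q z\<close> is a rule that may depend on the error rates; \<open>S\<close> and \<open>f\<close> may not.
  The parameter \<open>V\<close> is the set of values of the scoring rule \<open>S\<close>, on which \<open>f\<close> is a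
  strictly increasing self-map: \<open>{0..}\<close> for nonnegative scoring rules, \<open>UNIV\<close> for
  arbitrary real ones.  The rule \<open>R\<close> itself is real-valued.  Requiring also \<open>R \<ge> 0\<close> at
  all error rates would exclude \<open>SSR_alpha S\<close> for every strictly proper \<open>S\<close>:
  $e^-=0$, $e^+\to 1$ gives $S(q,1)\ge S(q,0)$ and $e^+=0$, $e^-\to 1$ gives the converse,
  so the score would not depend on the outcome.
\<close>

definition surrogate_scoring_rule ::
    "real set \<Rightarrow> (real \<Rightarrow> real \<Rightarrow> real \<Rightarrow> bool \<Rightarrow> real) \<Rightarrow> bool" where
  "surrogate_scoring_rule V R \<longleftrightarrow>
     (\<exists>S f. strictly_proper_scoring_rule S \<and> (\<forall>q\<in>{0..1}. \<forall>y. S q y \<in> V) \<and>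
        f \<in> V \<rightarrow> V \<and> strict_mono_on V f \<and>
        (\<forall>p\<in>{0..1}. \<forall>q\<in>{0..1}. \<forall>ep\<in>{0..1}. \<forall>em\<in>{0..1}. ep + em \<noteq> 1 \<longrightarrow>
           measure_pmf.expectation (noisy_truth p ep em) (R ep em q) =
           f (measure_pmf.expectation (bernoulli_pmf p) (S q))))"

definition SSR_alpha ::
    "(real \<Rightarrow> bool \<Rightarrow> real) \<Rightarrow> real \<Rightarrow> real \<Rightarrow> real \<Rightarrow> bool \<Rightarrow> real" where
  "SSR_alpha S ep em q z =
     (if z then ((1 - em) * S q True - ep * S q False) / (1 - ep - em)
      else ((1 - ep) * S q False - em * S q True) / (1 - ep - em))"

end

theory Submission imports Defs begin

text \<open>Conditioning on \<open>y\<close> turns the noise into the matrix with rows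
  \<open>(1 - ep, ep)\<close> and \<open>(em, 1 - em)\<close>, of determinant
  \<open>1 - ep - em\<close>. \<open>SSR_alpha\<close> is the inverse of this matrix applied to the
  scores of \<open>S\<close>, so averaging over the noise gives back \<open>S q y\<close>. Averaging
  over \<open>y\<close> as well yields the expected score of \<open>S\<close>, whence
  \<open>S\<close> itself and the identity witness the surrogate property.\<close>

lemma expectation_noisy_given_SSR_alpha:
  assumes "ep \<in> {0..1}" "em \<in> {0..1}" "ep + em \<noteq> 1"
  shows "measure_pmf.expectation (noisy_given ep em y) (SSR_alpha S ep em q) = S q y"
proof -
  \<comment> \<open>Eliminating \<open>em\<close> in favour of the determinant \<open>d\<close>
    reduces the denominator to one nonzero variable, which \<open>divide_simps\<close> can
    clear.\<close>
  define d where "d = 1 - ep - em"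
  have "d \<noteq> 0" and em: "em = 1 - ep - d"
    using assms(3) by (auto simp: d_def)
  then have "(1 - ep) * SSR_alpha S ep em q True + ep * SSR_alpha S ep em q False = S q True"
    and "em * SSR_alpha S ep em q True + (1 - em) * SSR_alpha S ep em q False = S q False"
    unfolding SSR_alpha_def em by (simp_all add: divide_simps) (simp_all add: algebra_simps)
  \<comment> \<open>The ranges of \<open>ep\<close> and \<open>em\<close> keep the Bernoulli
    parameters in [0,1], so the expectation is the weighted sum above.\<close>
  then show ?thesis
    using assms(1,2) by (cases y) (simp_all add: noisy_given_def mult.commute)
qed

text \<open>Tower property; as \<open>bool\<close> is finite, both sides are finite sums over
  \<open>y\<close>.\<close>

lemma expectation_noisy_truth:
  fixes g :: "bool \<Rightarrow> real"
  shows "measure_pmf.expectation (noisy_truth p ep em) g =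
    measure_pmf.expectation (bernoulli_pmf p)
      (\<lambda>y. measure_pmf.expectation (noisy_given ep em y) g)"
  unfolding noisy_truth_def
  by (subst pmf_expectation_bind[where A = UNIV])
    (simp_all add: integral_measure_pmf[where A = UNIV])

lemma expectation_noisy_truth_SSR_alpha:
  assumes "ep \<in> {0..1}" "em \<in> {0..1}" "ep + em \<noteq> 1"
  shows "measure_pmf.expectation (noisy_truth p ep em) (SSR_alpha S ep em q) =
    measure_pmf.expectation (bernoulli_pmf p) (S q)"
  by (simp add: expectation_noisy_truth expectation_noisy_given_SSR_alpha[OF assms])

lemma surrogate_scoring_rule_SSR_alpha:
  assumes "strictly_proper_scoring_rule S" "\<forall>q\<in>{0..1}. \<forall>y. S q y \<in> V"
  shows "surrogate_scoring_rule V (SSR_alpha S)"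
  unfolding surrogate_scoring_rule_def
  using assms
  \<comment> \<open>The identity is a strictly increasing self-map of every \<open>V\<close>, which
    covers real and nonnegative scores alike.\<close>
  by (intro exI[of _ S] exI[of _ "\<lambda>x. x"])
    (simp add: expectation_noisy_truth_SSR_alpha strict_mono_on_def)

theorem theorem4p8:
  fixes S :: "real \<Rightarrow> bool \<Rightarrow> real"
  assumes "strictly_proper_scoring_rule S"
  shows "surrogate_scoring_rule UNIV (SSR_alpha S)
    \<and> ((\<forall>q\<in>{0..1}. \<forall>y. S q y \<ge> 0) \<longrightarrow> surrogate_scoring_rule {0..} (SSR_alpha S))
    \<and> (\<forall>p\<in>{0..1}. \<forall>q\<in>{0..1}. \<forall>ep\<in>{0..1}. \<forall>em\<in>{0..1}. ep + em \<noteq> 1 \<longrightarrow>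
         measure_pmf.expectation (noisy_truth p ep em) (SSR_alpha S ep em q) =
         measure_pmf.expectation (bernoulli_pmf p) (S q))"
  using assms
  by (simp add: surrogate_scoring_rule_SSR_alpha expectation_noisy_truth_SSR_alpha)

end
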